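(* Every connected $\{K_2+2K_1, P_4, C_4\}$-free graph $G$ (finite, simple, undirected, with $n \ge 2$ vertices) is well-burnable, i.e. $b(G) \leq \lceil \sqrt{n}\, \rceil$.
   Context: A graph is $\{K_2+2K_1, P_4, C_4\}$-free if it contains none of the following as an induced subgraph: $K_2+2K_1$ (the four-vertex graph that is the disjoint union of one edge and two isolated vertices), $P_4$ (the path on four vertices), $C_4$ (the cycle on four vertices). Graph burning: initially all vertices of a finite simple undirected graph $G$ are unburned. The process runs in rounds $t = 1, 2, 3, \dots$. In round $t$, a vertex $x_t$ that is not burned at the end of round $t-1$ is chosen as a new source of fire and becomes burned; simultaneously, every vertex adjacent to a vertex that was burned at the end of round $t-1$ becomes burned. Burned vertices remain burned. The process ends at the first round after which all vertices of $G$ are burned. The burning number $b(G)$ is the minimum, over all choices of sources, of the number of rounds needed to burn all vertices of $G$. A connected graph $G$ on $n$ vertices is called well-burnable if $b(G) \leq \lceil \sqrt{n}\, \rceil$. *)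

theory Defs
  imports Complex_Main "Graph_Theory.Graph_Theory"
begin

text \<open>
  A finite simple undirected graph is a symmetric, finite digraph without loops and without
  parallel arcs, i.e. an instance of the locale \<^locale>\<open>graph\<close>; the edge \<open>uv\<close> is the pair of arcs
  \<open>(u, v)\<close>, \<open>(v, u)\<close>.
\<close>

definition induced_free ::
  "('c, 'd) pre_digraph \<Rightarrow> ('a, 'b) pre_digraph \<Rightarrow> bool" where
  "induced_free F G \<longleftrightarrow> \<not> (\<exists>I. induced_subgraph I G \<and> digraph_iso F I)"

definition K2_2K1 :: "nat pair_pre_digraph" where
  "K2_2K1 = \<lparr> pverts = {0, 1, 2, 3}, parcs = {(0, 1), (1, 0)} \<rparr>"

definition P4 :: "nat pair_pre_digraph" where
  "P4 = \<lparr> pverts = {0, 1, 2, 3},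
          parcs = {(0, 1), (1, 0), (1, 2), (2, 1), (2, 3), (3, 2)} \<rparr>"

definition C4 :: "nat pair_pre_digraph" where
  "C4 = \<lparr> pverts = {0, 1, 2, 3},
          parcs = {(0, 1), (1, 0), (1, 2), (2, 1), (2, 3), (3, 2), (3, 0), (0, 3)} \<rparr>"

lemma pair_graph_patterns: "pair_graph K2_2K1" "pair_graph P4" "pair_graph C4"
  by (unfold_locales; auto simp: K2_2K1_def P4_def C4_def symmetric_def sym_def)+


text \<open>\<open>burned G x t\<close> is the set of vertices burned at the end of round \<open>t\<close> when \<open>x t\<close> is the
  source chosen in round \<open>t \<ge> 1\<close>; the value \<open>x 0\<close> is irrelevant.\<close>

primrec burned :: "('a, 'b) pre_digraph \<Rightarrow> (nat \<Rightarrow> 'a) \<Rightarrow> nat \<Rightarrow> 'a set" where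
  "burned G x 0 = {}"
| "burned G x (Suc t) =
     burned G x t \<union> {x (Suc t)} \<union> {v. \<exists>u \<in> burned G x t. u \<rightarrow>\<^bsub>G\<^esub> v}"

definition legal_sources :: "('a, 'b) pre_digraph \<Rightarrow> (nat \<Rightarrow> 'a) \<Rightarrow> nat \<Rightarrow> bool" where
  "legal_sources G x k \<longleftrightarrow> (\<forall>t \<in> {1..k}. x t \<in> verts G - burned G x (t - 1))"

text \<open>Legality forces every source to be unburned when chosen, so the \<open>k\<close> below is
  automatically the first round after which all vertices are burned.\<close>

definition burns_in :: "('a, 'b) pre_digraph \<Rightarrow> (nat \<Rightarrow> 'a) \<Rightarrow> nat \<Rightarrow> bool" where
  "burns_in G x k \<longleftrightarrow> legal_sources G x k \<and> burned G x k = verts G"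

definition burning_number :: "('a, 'b) pre_digraph \<Rightarrow> nat" where
  "burning_number G = (LEAST k. \<exists>x. burns_in G x k)"

definition well_burnable :: "('a, 'b) pre_digraph \<Rightarrow> bool" where
  "well_burnable G \<longleftrightarrow> int (burning_number G) \<le> \<lceil>sqrt (real (card (verts G)))\<rceil>"


text \<open>On a finite graph some choice of sources burns everything, so the minimum in
  \<^const>\<open>burning_number\<close> is over a nonempty set.\<close>

lemma burned_cong:
  assumes "\<And>t. 1 \<le> t \<Longrightarrow> t \<le> k \<Longrightarrow> x t = y t"
  shows "burned G x k = burned G y k"
  using assms by (induction k) auto

lemma burned_subset_verts:
  assumes "wf_digraph G" "legal_sources G x k"
  shows "burned G x k \<subseteq> verts G"
  using assms(2)
proof (induction k)
  case (Suc k)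
  have "legal_sources G x k" using Suc.prems by (auto simp: legal_sources_def)
  moreover have "x (Suc k) \<in> verts G" using Suc.prems by (auto simp: legal_sources_def)
  moreover have "v \<in> verts G" if "u \<rightarrow>\<^bsub>G\<^esub> v" for u v
    using that wf_digraph.head_in_verts[OF assms(1)] by (auto simp: arcs_ends_conv)
  ultimately show ?case using Suc.IH by auto
qed simp

lemma ex_burns_in:
  assumes "graph G"
  shows "\<exists>k x. burns_in G x k"
proof (rule ccontr)
  assume no: "\<nexists>k x. burns_in G x k"
  interpret graph G by fact
  have "\<exists>x. legal_sources G x k \<and> k \<le> card (burned G x k)" for k
  proof (induction k)
    case 0
    show ?case by (auto simp: legal_sources_def)
  next
    case (Suc k)
    then obtain x where x: "legal_sources G x k" "k \<le> card (burned G x k)" by blast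
    have sub: "burned G x k \<subseteq> verts G" by (rule burned_subset_verts[OF wf_digraph x(1)])
    with no x(1) obtain s where s: "s \<in> verts G" "s \<notin> burned G x k"
      unfolding burns_in_def by blast
    define y where "y = x(Suc k := s)"
    have same: "burned G y t = burned G x t" if "t \<le> k" for t
      using that by (intro burned_cong) (auto simp: y_def)
    have legal: "legal_sources G y (Suc k)"
      unfolding legal_sources_def
    proof
      fix t assume t: "t \<in> {1..Suc k}"
      show "y t \<in> verts G - burned G y (t - 1)"
      proof (cases "t = Suc k")
        case True
        then show ?thesis using s same[of k] by (simp add: y_def)
      next
        case False
        then have "t \<in> {1..k}" using t by auto
        then show ?thesis using x(1) same[of "t - 1"] False
          by (auto simp: legal_sources_def y_def)
      qed
    qed
    have "insert s (burned G x k) \<subseteq> burned G y (Suc k)"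
      using same[of k] by (auto simp: y_def)
    moreover have "finite (burned G y (Suc k))"
      using burned_subset_verts[OF wf_digraph legal] finite_verts by (rule finite_subset)
    ultimately have "card (insert s (burned G x k)) \<le> card (burned G y (Suc k))"
      by (intro card_mono)
    moreover have "card (insert s (burned G x k)) = Suc (card (burned G x k))"
      using s finite_subset[OF sub finite_verts] by simp
    ultimately show ?case using legal x(2) by (intro exI[of _ y]) simp
  qed
  then obtain x where "legal_sources G x (Suc (card (verts G)))"
    "Suc (card (verts G)) \<le> card (burned G x (Suc (card (verts G))))" by blast
  with card_mono[OF finite_verts burned_subset_verts[OF wf_digraph]] show False
    by (meson not_less_eq_eq order_trans order_refl)
qed

end

theory Submission
  imports Defs
begin

text \<open>
  A vertex of maximum degree in a connected \<open>{P4, C4}\<close>-free graph is universal: otherwise it has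
  a neighbour \<open>u\<close> with a neighbour \<open>w\<close> outside its closed neighbourhood, and by maximality a
  neighbour \<open>x\<close> outside that of \<open>u\<close>, so that \<open>x, v, u, w\<close> induce a \<open>P4\<close> or a \<open>C4\<close>. Fire started
  at a universal vertex covers the graph in two rounds, and \<open>\<lceil>sqrt n\<rceil> \<ge> 2\<close> for \<open>n \<ge> 2\<close>.
\<close>

text \<open>Arcs of \<open>G\<close> are abstract objects, whereas those of \<open>F\<close> are
  pairs. Without parallel arcs an arc is determined by its ends, so a vertex map that preserves and
  reflects adjacency already fixes the arc map, and patterns can be exhibited by vertices
  alone.\<close>

lemma (in nomulti_digraph) not_induced_freeI:
  assumes wf: "pair_wf_digraph F"
    and inj: "inj_on f (pverts F)"
    and sub: "f ` pverts F \<subseteq> verts G"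
    and adj: "\<And>a b. a \<in> pverts F \<Longrightarrow> b \<in> pverts F \<Longrightarrow> f a \<rightarrow> f b \<longleftrightarrow> (a, b) \<in> parcs F"
  shows "\<not> induced_free (with_proj F) G"
proof -
  interpret F: pair_wf_digraph F by (rule wf)
  \<comment> \<open>The arc of \<open>G\<close> joining the images of the ends of \<open>p\<close>;
    on \<open>parcs F\<close> it exists by \<open>adj\<close>.\<close>
  define g where "g = (\<lambda>p. inv_into (arcs G) (arc_to_ends G) (map_prod f f p))"
  have g: "g p \<in> arcs G" "tail G (g p) = f (fst p)" "head G (g p) = f (snd p)"
    if "p \<in> parcs F" for p
  proof -
    have *: "map_prod f f p \<in> arc_to_ends G ` arcs G"
      using that adj[of "fst p" "snd p"] F.in_arcsD1[of "fst p" "snd p"]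
        F.in_arcsD2[of "fst p" "snd p"]
      by (simp add: arcs_ends_def map_prod_def case_prod_beta)
    show "g p \<in> arcs G" unfolding g_def by (rule inv_into_into[OF *])
    show "tail G (g p) = f (fst p)" "head G (g p) = f (snd p)"
      using f_inv_into_f[OF *] by (simp_all add: g_def arc_to_ends_def map_prod_def case_prod_beta)
  qed
  have g_surj: "e \<in> g ` parcs F"
    if e: "e \<in> arcs G" "tail G e \<in> f ` pverts F" "head G e \<in> f ` pverts F" for e
  proof -
    obtain a b where ab: "a \<in> pverts F" "b \<in> pverts F" "tail G e = f a" "head G e = f b"
      using e by auto
    then have p: "(a, b) \<in> parcs F"
      using adj[of a b] e(1) in_arcs_imp_in_arcs_ends[OF e(1)] by simp
    have "e = g (a, b)"
      using g[OF p] ab e(1) by (intro no_multi_arcs) (auto simp: arc_to_ends_def)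
    with p show ?thesis by blast
  qed
  \<comment> \<open>Reusing \<open>head G\<close> and \<open>tail G\<close> makes the image of
    \<open>F\<close> literally equal to the induced subgraph as a record, once the arc sets agree
    (\<open>img\<close>).\<close>
  let ?h = "\<lparr> iso_verts = f, iso_arcs = g, iso_head = head G, iso_tail = tail G \<rparr>"
  have "inj_on g (parcs F)"
  proof (rule inj_onI)
    fix p q assume pq: "p \<in> parcs F" "q \<in> parcs F" "g p = g q"
    then have "f (fst p) = f (fst q)" "f (snd p) = f (snd q)"
      using g[of p] g[of q] by simp_all
    then show "p = q"
      using pq inj F.in_arcsD1[of "fst p" "snd p"] F.in_arcsD2[of "fst p" "snd p"]
        F.in_arcsD1[of "fst q" "snd q"] F.in_arcsD2[of "fst q" "snd q"]
      by (auto intro!: prod_eqI dest: inj_onD)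
  qed
  then have iso: "pre_digraph.digraph_isomorphism (with_proj F) ?h"
    unfolding pre_digraph.digraph_isomorphism_def
    using F.wf_digraph inj g by simp
  have img: "g ` parcs F
      = {e \<in> arcs G. tail G e \<in> f ` pverts F \<and> head G e \<in> f ` pverts F}"
  proof (intro equalityI subsetI)
    fix e assume "e \<in> g ` parcs F"
    then obtain a b where p: "(a, b) \<in> parcs F" "e = g (a, b)" by auto
    then show "e \<in> {e \<in> arcs G. tail G e \<in> f ` pverts F \<and> head G e \<in> f ` pverts F}"
      using g[OF p(1)] F.in_arcsD1[OF p(1)] F.in_arcsD2[OF p(1)] by simp
  qed (use g_surj in blast)
  have "G \<restriction> f ` pverts F = app_iso ?h (with_proj F)"
    by (intro pre_digraph.equality) (simp_all add: img)
  then have "digraph_iso (with_proj F) (G \<restriction> f ` pverts F)"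
    using iso unfolding digraph_iso_def by blast
  moreover have "induced_subgraph (G \<restriction> f ` pverts F) G"
    using sub by (rule induced_induce)
  ultimately show ?thesis unfolding induced_free_def by blast
qed

lemma (in graph) ex_universal_vertex:
  assumes con: "Digraph_Component.connected G"
    and P4: "induced_free (with_proj P4) G"
    and C4: "induced_free (with_proj C4) G"
  shows "\<exists>v \<in> verts G. \<forall>w \<in> verts G. w \<noteq> v \<longrightarrow> v \<rightarrow> w"
proof -
  \<comment> \<open>Closed neighbourhoods have size degree plus one, so maximising
    \<open>card (N v)\<close> maximises the degree. Unlike open ones, those of adjacent vertices can
    be nested.\<close>
  define N where "N v = insert v {w. v \<rightarrow> w}" for v
  have N_sub: "N v \<subseteq> verts G" if "v \<in> verts G" for v
    using that adj_in_verts by (auto simp: N_def)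
  then have fin_N: "finite (N v)" if "v \<in> verts G" for v
    using that finite_subset finite_verts by blast
  \<comment> \<open>Connectedness is defined through the symmetric closure; as the arcs are
    symmetric, it yields reachability in \<open>G\<close> itself.\<close>
  have sc: "strongly_connected G"
    using con unfolding connected_def strongly_connected_def
    by (simp add: reachable_mk_symmetric_eq[OF sym_arcs])
  then have ne: "verts G \<noteq> {}" by (simp add: strongly_connected_def)
  have "\<exists>v \<in> verts G. \<forall>u \<in> verts G. card (N u) \<le> card (N v)"
    using ne Max_in[of "(\<lambda>v. card (N v)) ` verts G"] Max_ge[of "(\<lambda>v. card (N v)) ` verts G"]
    by fastforce
  then obtain v where v: "v \<in> verts G" and max: "\<And>u. u \<in> verts G \<Longrightarrow> card (N u) \<le> card (N v)"
    by blast
  \<comment> \<open>Closure of \<open>N v\<close> under adjacency is the induction step along walks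
    from \<open>v\<close>.\<close>
  have step: "w \<in> N v" if u: "u \<in> N v" and uw: "u \<rightarrow> w" for u w
  proof (rule ccontr)
    assume w: "w \<notin> N v"
    then have vu: "v \<rightarrow> u" and nvw: "\<not> v \<rightarrow> w" and wv: "w \<noteq> v"
      using u uw by (auto simp: N_def)
    have uv: "u \<in> verts G" using vu adj_in_verts by blast
    \<comment> \<open>Otherwise \<open>N v\<close> is contained in \<open>N u\<close>, strictly
      because of \<open>w\<close>, against the maximality of \<open>v\<close>.\<close>
    obtain x where x: "x \<in> N v" "x \<notin> N u"
    proof (rule ccontr)
      assume "\<not> thesis"
      then have "N v \<subset> N u" using that w uw by (auto simp: N_def)
      then have "card (N v) < card (N u)" by (rule psubset_card_mono[OF fin_N[OF uv]])
      with max[OF uv] show False by simp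
    qed
    have sym: "a \<rightarrow> b \<longleftrightarrow> b \<rightarrow> a" for a b
      using sym_arcs by (auto simp: symmetric_def dest: symD)
    have uv': "u \<rightarrow> v" using vu sym by blast
    have vx: "v \<rightarrow> x" and nux: "\<not> u \<rightarrow> x" and xu: "x \<noteq> u"
      using x uv' by (auto simp: N_def)
    have irr: "\<not> a \<rightarrow> a" for a using adj_not_same by blast
    have dist: "x \<noteq> v" "x \<noteq> w" "v \<noteq> u" "u \<noteq> w"
      using vx vu uw nvw irr by auto
    \<comment> \<open>Listed in path order, so that pattern vertices 0 to 3 match. Only the
      adjacency of the ends \<open>x\<close> and \<open>w\<close> is still open: present it closes a
      \<open>C4\<close>, absent it leaves a \<open>P4\<close>.\<close>
    define f where "f = (!) [x, v, u, w]"
    have f: "f 0 = x" "f (Suc 0) = v" "f 2 = u" "f 3 = w"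
      by (simp_all add: f_def eval_nat_numeral)
    have inj: "inj_on f {0, 1, 2, 3}"
      using dist xu wv by (simp add: f)
    have sub: "f ` {0, 1, 2, 3} \<subseteq> verts G"
      using vx vu uw adj_in_verts by (auto simp: f)
    have adj: "v \<rightarrow> x" "x \<rightarrow> v" "v \<rightarrow> u" "u \<rightarrow> v" "u \<rightarrow> w" "w \<rightarrow> u"
      "\<not> v \<rightarrow> w" "\<not> w \<rightarrow> v" "\<not> u \<rightarrow> x" "\<not> x \<rightarrow> u"
      using vx vu uw nvw nux sym by blast+
    show False
    proof (cases "x \<rightarrow> w")
      case True
      then have wx: "w \<rightarrow> x" using sym by blast
      interpret C4: pair_graph C4 by (rule pair_graph_patterns)
      have "\<not> induced_free (with_proj C4) G"
      proof (rule not_induced_freeI)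
        show "pair_wf_digraph C4" by unfold_locales
        show "inj_on f (pverts C4)" "f ` pverts C4 \<subseteq> verts G"
          using inj sub by (simp_all add: C4_def)
        show "f a \<rightarrow> f b \<longleftrightarrow> (a, b) \<in> parcs C4" if "a \<in> pverts C4" "b \<in> pverts C4" for a b
          using that by (simp only: C4_def pair_pre_digraph.simps insert_iff empty_iff)
            (elim disjE; simp add: f adj wx irr True)
      qed
      with C4 show False by simp
    next
      case False
      then have wx: "\<not> w \<rightarrow> x" using sym by blast
      interpret P4: pair_graph P4 by (rule pair_graph_patterns)
      have "\<not> induced_free (with_proj P4) G"
      proof (rule not_induced_freeI)
        show "pair_wf_digraph P4" by unfold_locales
        show "inj_on f (pverts P4)" "f ` pverts P4 \<subseteq> verts G"
          using inj sub by (simp_all add: P4_def)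
        show "f a \<rightarrow> f b \<longleftrightarrow> (a, b) \<in> parcs P4" if "a \<in> pverts P4" "b \<in> pverts P4" for a b
          using that by (simp only: P4_def pair_pre_digraph.simps insert_iff empty_iff)
            (elim disjE; simp add: f adj wx irr False)
      qed
      with P4 show False by simp
    qed
  qed
  have "w \<in> N v" if "v \<rightarrow>\<^sup>* w" for w
    using that by (induction rule: reachable_induct) (simp add: N_def, rule step)
  then have "verts G \<subseteq> N v" using sc v by (auto simp: strongly_connected_def)
  then show ?thesis using v by (auto simp: N_def)
qed

lemma burning_number_le_2:
  assumes v: "v \<in> verts G" and univ: "\<And>w. w \<in> verts G \<Longrightarrow> w \<noteq> v \<Longrightarrow> v \<rightarrow>\<^bsub>G\<^esub> w"
    and wf: "wf_digraph G" and card: "card (verts G) \<ge> 2"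
  shows "burning_number G \<le> 2"
proof -
  \<comment> \<open>Round 2 also needs a source that is unburned after round 1, when only
    \<open>v\<close> burns.\<close>
  obtain u where u: "u \<in> verts G" "u \<noteq> v"
    using card v by (metis card_2_iff' obtain_subset_with_card_n subsetD)
  define x where "x t = (if t = Suc 0 then v else u)" for t
  have legal: "legal_sources G x 2"
    using u v by (auto simp: legal_sources_def x_def numeral_2_eq_2 le_Suc_eq)
  have "verts G \<subseteq> burned G x 2"
    using univ by (auto simp: x_def numeral_2_eq_2)
  with burned_subset_verts[OF wf legal] legal have "burns_in G x 2"
    by (auto simp: burns_in_def)
  then show ?thesis unfolding burning_number_def by (blast intro: Least_le)
qed

theorem mainTheorem6:
  fixes G :: "('a, 'b) pre_digraph"
  assumes "graph G"
    and "card (verts G) \<ge> 2"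
    and "Digraph_Component.connected G"
    and "induced_free (with_proj K2_2K1) G"
    and "induced_free (with_proj P4) G"
    and "induced_free (with_proj C4) G"
  shows "well_burnable G"
proof -
  interpret graph G by fact
  obtain v where "v \<in> verts G" "\<And>w. w \<in> verts G \<Longrightarrow> w \<noteq> v \<Longrightarrow> v \<rightarrow>\<^bsub>G\<^esub> w"
    using ex_universal_vertex[OF assms(3,5,6)] by blast
  then have "burning_number G \<le> 2"
    using wf_digraph assms(2) by (rule burning_number_le_2)
  \<comment> \<open>Strictness matters: a ceiling is at least 2 exactly when its argument exceeds
    1.\<close>
  moreover have "sqrt 1 < sqrt (real (card (verts G)))"
    using assms(2) by (intro real_sqrt_less_mono) simp
  then have "2 \<le> \<lceil>sqrt (real (card (verts G)))\<rceil>" by (simp add: le_ceiling_iff)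
  ultimately show ?thesis unfolding well_burnable_def by linarith
qed

end
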